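(* For $Z\in\{RT,FT,R,F\}$ and all closed BCCSP terms $p,q$: $p\le_I^{l(Z)}q$ if and only if $\{B_1\text{--}B_4,(RS),(ND^Z)\}\vdash p\preceq q$, where $l(RT)=l$, $l(FT)=l\supseteq$, $l(R)=lf$, $l(F)=lf\supseteq$.
   Context: BCCSP processes over a set $\mathit{Act}$: $p ::= \mathbf{0}\mid ap\mid p+q$; transitions $ap\xrightarrow{a}p$, and $p\xrightarrow{a}p'$ implies $p+q\xrightarrow{a}p'$ and $q+p\xrightarrow{a}p'$. $I(p)=\{a\mid\exists p'.\,p\xrightarrow{a}p'\}$. $\mathit{LGO}_I(p)$ is the set of sequences $X_0a_1X_1\cdots a_nX_n$ ($n\ge0$) for which some path $p=p_0\xrightarrow{a_1}\cdots\xrightarrow{a_n}p_n$ has $X_i=I(p_i)$ for all $i$. Orders: $p\le_I^{l}q$ iff $\mathit{LGO}_I(p)\subseteq\mathit{LGO}_I(q)$; $p\le_I^{l\supseteq}q$ iff for every $X_0a_1\cdots a_nX_n\in\mathit{LGO}_I(p)$ there is $Y_0a_1\cdots a_nY_n\in\mathit{LGO}_I(q)$ with $X_i\supseteq Y_i$ for all $i$; $p\le_I^{lf}q$: same but requiring only $X_n=Y_n$; $p\le_I^{lf\supseteq}q$: same but requiring only $X_n\supseteq Y_n$. Derivability $E\vdash t\preceq u$ uses reflexivity, transitivity, closure under prefixing and $+$, and closed substitution instances of axioms (conditional axioms only under closed substitutions satisfying the condition); $t\simeq u$ abbreviates both inequations. Axioms: $(B_1)$ $x+y\simeq y+x$;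 $(B_2)$ $(x+y)+z\simeq x+(y+z)$; $(B_3)$ $x+x\simeq x$; $(B_4)$ $x+\mathbf{0}\simeq x$; $(RS)$ $I(x)=I(y)\Rightarrow x\preceq x+y$; $(ND^Z)$ $M_Z(x,y,w)\Rightarrow a(x+y)\preceq ax+a(y+w)$ (each $a\in\mathit{Act}$), where $M_F$ is always true, $M_R(x,y,w)\iff I(x)\supseteq I(y)$, $M_{FT}(x,y,w)\iff I(w)\subseteq I(y)$, $M_{RT}(x,y,w)\iff I(x)=I(y)$ and $I(w)\subseteq I(y)$. *)

theory Defs
  imports Main
begin

section \<open>Closed BCCSP terms\<close>

text \<open>The set of actions is the carrier of the type variable \<open>'a\<close>; it may be finite or infinite.\<close>

datatype 'a proc =
    Stop ("\<zero>")
  | Prefix 'a "'a proc"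
  | Plus "'a proc" "'a proc" (infixl "\<oplus>" 65)

inductive step :: "'a proc \<Rightarrow> 'a \<Rightarrow> 'a proc \<Rightarrow> bool" where
  prefix: "step (Prefix a p) a p"
| plus_left: "step p a p' \<Longrightarrow> step (p \<oplus> q) a p'"
| plus_right: "step p a p' \<Longrightarrow> step (q \<oplus> p) a p'"

definition initials :: "'a proc \<Rightarrow> 'a set" where
  "initials p = {a. \<exists>p'. step p a p'}"

section \<open>Linear observations\<close>

text \<open>A path \<open>p\<^sub>0 \<rightarrow> p\<^sub>1 \<rightarrow> \<dots> \<rightarrow> p\<^sub>n\<close> with labels \<open>a\<^sub>1, \<dots>, a\<^sub>n\<close> is given by \<open>p\<^sub>0\<close>
  and the list \<open>[(a\<^sub>1, p\<^sub>1), \<dots>, (a\<^sub>n, p\<^sub>n)]\<close>.\<close>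

fun path :: "'a proc \<Rightarrow> ('a \<times> 'a proc) list \<Rightarrow> bool" where
  "path p [] \<longleftrightarrow> True"
| "path p ((a, p') # ps) \<longleftrightarrow> step p a p' \<and> path p' ps"

text \<open>The observation \<open>X\<^sub>0 a\<^sub>1 X\<^sub>1 \<dots> a\<^sub>n X\<^sub>n\<close> is encoded as \<open>(X\<^sub>0, [(a\<^sub>1, X\<^sub>1), \<dots>, (a\<^sub>n, X\<^sub>n)])\<close>.\<close>

type_synonym 'a obs = "'a set \<times> ('a \<times> 'a set) list"

definition LGO :: "'a proc \<Rightarrow> 'a obs set" where
  "LGO p = {(initials p, map (\<lambda>(a, p'). (a, initials p')) ps) |ps. path p ps}"

definition obs_actions :: "'a obs \<Rightarrow> 'a list" where
  "obs_actions \<sigma> = map fst (snd \<sigma>)"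

definition obs_sets :: "'a obs \<Rightarrow> 'a set list" where
  "obs_sets \<sigma> = fst \<sigma> # map snd (snd \<sigma>)"

definition le_l :: "'a proc \<Rightarrow> 'a proc \<Rightarrow> bool" where
  "le_l p q \<longleftrightarrow> LGO p \<subseteq> LGO q"

definition le_l_sup :: "'a proc \<Rightarrow> 'a proc \<Rightarrow> bool" where
  "le_l_sup p q \<longleftrightarrow> (\<forall>\<sigma>\<in>LGO p. \<exists>\<rho>\<in>LGO q.
     obs_actions \<sigma> = obs_actions \<rho> \<and> list_all2 (\<supseteq>) (obs_sets \<sigma>) (obs_sets \<rho>))"

definition le_lf :: "'a proc \<Rightarrow> 'a proc \<Rightarrow> bool" where
  "le_lf p q \<longleftrightarrow> (\<forall>\<sigma>\<in>LGO p. \<exists>\<rho>\<in>LGO q.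
     obs_actions \<sigma> = obs_actions \<rho> \<and> last (obs_sets \<sigma>) = last (obs_sets \<rho>))"

definition le_lf_sup :: "'a proc \<Rightarrow> 'a proc \<Rightarrow> bool" where
  "le_lf_sup p q \<longleftrightarrow> (\<forall>\<sigma>\<in>LGO p. \<exists>\<rho>\<in>LGO q.
     obs_actions \<sigma> = obs_actions \<rho> \<and> last (obs_sets \<sigma>) \<supseteq> last (obs_sets \<rho>))"

text \<open>\<open>RT\<close>: ready traces, \<open>FT\<close>: failure traces, \<open>RD\<close>: readies (written \<open>R\<close> on paper),
  \<open>FL\<close>: failures (written \<open>F\<close> on paper).\<close>

datatype semantics = RT | FT | RD | FL

fun lin_le :: "semantics \<Rightarrow> 'a proc \<Rightarrow> 'a proc \<Rightarrow> bool" where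
  "lin_le RT = le_l"
| "lin_le FT = le_l_sup"
| "lin_le RD = le_lf"
| "lin_le FL = le_lf_sup"

section \<open>Conditional inequational axioms and derivability\<close>

datatype var = VX | VY | VZ | VW

datatype 'a trm =
    Var var
  | TStop
  | TPrefix 'a "'a trm"
  | TPlus "'a trm" "'a trm" (infixl "[+]" 65)

primrec subst :: "(var \<Rightarrow> 'a proc) \<Rightarrow> 'a trm \<Rightarrow> 'a proc" where
  "subst s (Var v) = s v"
| "subst s TStop = \<zero>"
| "subst s (TPrefix a t) = Prefix a (subst s t)"
| "subst s (t [+] u) = subst s t \<oplus> subst s u"

text \<open>In \<open>Axiom c t u\<close>, read \<open>c \<Rightarrow> t \<preceq> u\<close>; the condition \<open>c\<close> is a predicate on closed substitutions.\<close>

datatype 'a cineq = Axiom "(var \<Rightarrow> 'a proc) \<Rightarrow> bool" "'a trm" "'a trm"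

inductive derivable :: "'a cineq set \<Rightarrow> 'a proc \<Rightarrow> 'a proc \<Rightarrow> bool" ("_ \<turnstile> _ \<preceq> _" [50, 51, 51] 50)
  for E :: "'a cineq set" where
  refl: "E \<turnstile> p \<preceq> p"
| trans: "E \<turnstile> p \<preceq> q \<Longrightarrow> E \<turnstile> q \<preceq> r \<Longrightarrow> E \<turnstile> p \<preceq> r"
| prefix: "E \<turnstile> p \<preceq> q \<Longrightarrow> E \<turnstile> Prefix a p \<preceq> Prefix a q"
| plus: "E \<turnstile> p \<preceq> q \<Longrightarrow> E \<turnstile> p' \<preceq> q' \<Longrightarrow> E \<turnstile> p \<oplus> p' \<preceq> q \<oplus> q'"
| inst: "Axiom c t u \<in> E \<Longrightarrow> c s \<Longrightarrow> E \<turnstile> subst s t \<preceq> subst s u"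

definition equation :: "'a trm \<Rightarrow> 'a trm \<Rightarrow> 'a cineq set" where
  "equation t u = {Axiom (\<lambda>_. True) t u, Axiom (\<lambda>_. True) u t}"

definition B1 :: "'a cineq set" where
  "B1 = equation (Var VX [+] Var VY) (Var VY [+] Var VX)"

definition B2 :: "'a cineq set" where
  "B2 = equation ((Var VX [+] Var VY) [+] Var VZ) (Var VX [+] (Var VY [+] Var VZ))"

definition B3 :: "'a cineq set" where
  "B3 = equation (Var VX [+] Var VX) (Var VX)"

definition B4 :: "'a cineq set" where
  "B4 = equation (Var VX [+] TStop) (Var VX)"

definition RS :: "'a cineq set" where
  "RS = {Axiom (\<lambda>s. initials (s VX) = initials (s VY)) (Var VX) (Var VX [+] Var VY)}"

fun M :: "semantics \<Rightarrow> 'a proc \<Rightarrow> 'a proc \<Rightarrow> 'a proc \<Rightarrow> bool" where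
  "M FL x y w \<longleftrightarrow> True"
| "M RD x y w \<longleftrightarrow> initials x \<supseteq> initials y"
| "M FT x y w \<longleftrightarrow> initials w \<subseteq> initials y"
| "M RT x y w \<longleftrightarrow> initials x = initials y \<and> initials w \<subseteq> initials y"

definition ND :: "semantics \<Rightarrow> 'a cineq set" where
  "ND Z = {Axiom (\<lambda>s. M Z (s VX) (s VY) (s VW))
             (TPrefix a (Var VX [+] Var VY))
             (TPrefix a (Var VX) [+] TPrefix a (Var VY [+] Var VW)) |a. True}"

end

theory Submission
  imports Defs
begin

text \<open>
  All four preorders force equal initials, so \<open>p \<preceq> p \<oplus> q\<close> by \<open>(RS)\<close>, and completeness reduces to
  absorbing each summand \<open>Prefix a p'\<close> of \<open>p\<close> into \<open>q\<close>.  The processes \<open>r\<close> for which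
  \<open>Prefix a r\<close> is absorbed by \<open>q\<close> are closed under replacing \<open>x\<close> and \<open>y \<oplus> w\<close> by \<open>x \<oplus> y\<close> whenever
  \<open>M Z x y w\<close>.  Starting from one \<open>a\<close>-derivative of \<open>q\<close> that matches the initials of \<open>p'\<close>, one adds the
  parts of the other admissible \<open>a\<close>-derivatives whose first actions lie in \<open>initials p'\<close>.  The
  resulting \<open>r\<close> has the same initials as \<open>p'\<close> and dominates it, so induction gives \<open>p' \<preceq> r\<close>.
\<close>

section \<open>Transitions and initials\<close>

lemma step_Stop [simp]: "\<not> step \<zero> a p"
  by (auto elim: step.cases)

lemma step_Prefix [simp]: "step (Prefix a p) b p' \<longleftrightarrow> b = a \<and> p' = p"
  by (auto elim: step.cases intro: step.intros)

lemma step_Plus [simp]: "step (p \<oplus> q) a r \<longleftrightarrow> step p a r \<or> step q a r"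
  by (auto elim: step.cases intro: step.intros)

lemma initials_Prefix [simp]: "initials (Prefix a p) = {a}"
  by (auto simp: initials_def)

lemma initials_Plus [simp]: "initials (p \<oplus> q) = initials p \<union> initials q"
  by (auto simp: initials_def)

lemma step_initials: "step p a p' \<Longrightarrow> a \<in> initials p"
  by (auto simp: initials_def)

lemma step_size: "step p a p' \<Longrightarrow> size p' < size p"
  by (induction rule: step.induct) auto

lemma finite_derivatives: "finite {p'. step p a p'}"
  by (induction p) auto

text \<open>Serves to split a derivative into the \<open>y\<close> and \<open>w\<close> of the axiom
  in \<open>ND\<close>: the summands starting with an action of \<open>X\<close>, and the remaining
  ones.\<close>

primrec restrict :: "'a set \<Rightarrow> 'a proc \<Rightarrow> 'a proc" where
  "restrict X \<zero> = \<zero>"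
| "restrict X (Prefix a p) = (if a \<in> X then Prefix a p else \<zero>)"
| "restrict X (p \<oplus> q) = restrict X p \<oplus> restrict X q"

lemma step_restrict [simp]: "step (restrict X p) a p' \<longleftrightarrow> a \<in> X \<and> step p a p'"
  by (induction p) auto

lemma initials_restrict [simp]: "initials (restrict X p) = initials p \<inter> X"
  by (auto simp: initials_def)

section \<open>Matching observations\<close>

text \<open>The four orders differ only in how the last set of an observation is compared and how
  the earlier sets are. Separating the two comparisons lets one proof treat all values of
  \<open>Z\<close>.\<close>

fun final_ok :: "semantics \<Rightarrow> 'a set \<Rightarrow> 'a set \<Rightarrow> bool" where
  "final_ok RT X Y \<longleftrightarrow> X = Y"
| "final_ok FT X Y \<longleftrightarrow> Y \<subseteq> X"
| "final_ok RD X Y \<longleftrightarrow> X = Y"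
| "final_ok FL X Y \<longleftrightarrow> Y \<subseteq> X"

fun inner_ok :: "semantics \<Rightarrow> 'a set \<Rightarrow> 'a set \<Rightarrow> bool" where
  "inner_ok RT X Y \<longleftrightarrow> X = Y"
| "inner_ok FT X Y \<longleftrightarrow> Y \<subseteq> X"
| "inner_ok RD X Y \<longleftrightarrow> True"
| "inner_ok FL X Y \<longleftrightarrow> True"

lemma final_ok_refl [simp]: "final_ok Z X X"
  by (cases Z) auto

lemma inner_ok_refl [simp]: "inner_ok Z X X"
  by (cases Z) auto

lemma final_ok_trans: "final_ok Z X Y \<Longrightarrow> final_ok Z Y W \<Longrightarrow> final_ok Z X W"
  by (cases Z) auto

lemma inner_ok_trans: "inner_ok Z X Y \<Longrightarrow> inner_ok Z Y W \<Longrightarrow> inner_ok Z X W"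
  by (cases Z) auto

lemma final_ok_subset: "final_ok Z X Y \<Longrightarrow> Y \<subseteq> X"
  by (cases Z) auto

fun matches :: "semantics \<Rightarrow> 'a set \<Rightarrow> ('a \<times> 'a set) list \<Rightarrow> 'a set \<Rightarrow> ('a \<times> 'a set) list \<Rightarrow> bool" where
  "matches Z X [] Y [] \<longleftrightarrow> final_ok Z X Y"
| "matches Z X ((a, X') # \<sigma>) Y ((b, Y') # \<rho>) \<longleftrightarrow> inner_ok Z X Y \<and> a = b \<and> matches Z X' \<sigma> Y' \<rho>"
| "matches Z X _ Y _ \<longleftrightarrow> False"

lemma matches_trans:
  "matches Z X \<sigma> Y \<rho> \<Longrightarrow> matches Z Y \<rho> W \<tau> \<Longrightarrow> matches Z X \<sigma> W \<tau>"
proof (induction Z X \<sigma> Y \<rho> arbitrary: W \<tau> rule: matches.induct)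
  case (1 Z X Y)
  then show ?case by (cases \<tau>) (auto intro: final_ok_trans)
next
  case (2 Z X a X' \<sigma> Y b Y' \<rho>)
  then show ?case by (cases \<tau>) (auto intro: inner_ok_trans)
qed auto

lemma matches_iff:
  "matches Z X \<sigma> Y \<rho> \<longleftrightarrow> obs_actions (X, \<sigma>) = obs_actions (Y, \<rho>) \<and>
    (case Z of
      RT \<Rightarrow> obs_sets (X, \<sigma>) = obs_sets (Y, \<rho>)
    | FT \<Rightarrow> list_all2 (\<supseteq>) (obs_sets (X, \<sigma>)) (obs_sets (Y, \<rho>))
    | RD \<Rightarrow> last (obs_sets (X, \<sigma>)) = last (obs_sets (Y, \<rho>))
    | FL \<Rightarrow> last (obs_sets (X, \<sigma>)) \<supseteq> last (obs_sets (Y, \<rho>)))"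
  by (induction Z X \<sigma> Y \<rho> rule: matches.induct)
    (auto simp: obs_actions_def obs_sets_def split: semantics.splits)

text \<open>Needed because \<open>le_l\<close> is an inclusion of observation sets, whereas the
  other three orders already ask for a matching observation.\<close>

lemma matches_RT: "matches RT X \<sigma> Y \<rho> \<longleftrightarrow> (X, \<sigma>) = (Y, \<rho>)"
  by (induction "RT" X \<sigma> Y \<rho> rule: matches.induct) auto

lemma lin_le_iff_matches:
  "lin_le Z p q \<longleftrightarrow> (\<forall>X \<sigma>. (X, \<sigma>) \<in> LGO p \<longrightarrow> (\<exists>Y \<rho>. (Y, \<rho>) \<in> LGO q \<and> matches Z X \<sigma> Y \<rho>))"
proof (cases Z)
  case RT
  then show ?thesis by (auto simp: le_l_def matches_RT)
qed (fastforce simp: le_l_sup_def le_lf_def le_lf_sup_def matches_iff Ball_def Bex_def)+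

lemma lin_le_trans: "lin_le Z p q \<Longrightarrow> lin_le Z q r \<Longrightarrow> lin_le Z p r"
  unfolding lin_le_iff_matches by (meson matches_trans)

lemma LGO_Nil [simp]: "(X, []) \<in> LGO p \<longleftrightarrow> X = initials p"
  by (auto simp: LGO_def intro: exI[of _ "[]"])

lemma LGO_Cons [simp]:
  "(X, (a, Y) # \<sigma>) \<in> LGO p \<longleftrightarrow> X = initials p \<and> (\<exists>p'. step p a p' \<and> (Y, \<sigma>) \<in> LGO p')"
proof
  assume "(X, (a, Y) # \<sigma>) \<in> LGO p"
  then show "X = initials p \<and> (\<exists>p'. step p a p' \<and> (Y, \<sigma>) \<in> LGO p')"
    by (fastforce simp: LGO_def)
next
  assume "X = initials p \<and> (\<exists>p'. step p a p' \<and> (Y, \<sigma>) \<in> LGO p')"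
  then obtain p' ps where "X = initials p" "step p a p'" "path p' ps" "Y = initials p'"
    "\<sigma> = map (\<lambda>(a, p'). (a, initials p')) ps"
    by (auto simp: LGO_def)
  then show "(X, (a, Y) # \<sigma>) \<in> LGO p"
    by (auto simp: LGO_def intro!: exI[of _ "(a, p') # ps"])
qed

section \<open>Matching along the transitions of the right-hand process\<close>

fun allows :: "semantics \<Rightarrow> 'a proc \<Rightarrow> 'a set \<Rightarrow> ('a \<times> 'a set) list \<Rightarrow> bool" where
  "allows Z q X [] \<longleftrightarrow> final_ok Z X (initials q)"
| "allows Z q X ((a, Y) # \<sigma>) \<longleftrightarrow>
     inner_ok Z X (initials q) \<and> (\<exists>q'. step q a q' \<and> allows Z q' Y \<sigma>)"

text \<open>Choosing a path of \<open>q\<close> and comparing it with the observation can be done in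
  one recursion, so that \<open>q\<close> is followed transition by transition.\<close>

lemma allows_iff: "allows Z q X \<sigma> \<longleftrightarrow> (\<exists>Y \<rho>. (Y, \<rho>) \<in> LGO q \<and> matches Z X \<sigma> Y \<rho>)"
proof (induction Z q X \<sigma> rule: allows.induct)
  case (1 Z q X)
  have "(\<exists>Y \<rho>. (Y, \<rho>) \<in> LGO q \<and> matches Z X [] Y \<rho>) \<longleftrightarrow>
        (\<exists>Y. (Y, []) \<in> LGO q \<and> final_ok Z X Y)"
    by (metis matches.simps(1,4) neq_Nil_conv)
  then show ?case by simp
next
  case (2 Z q X a Y \<sigma>)
  have "(\<exists>W \<rho>. (W, \<rho>) \<in> LGO q \<and> matches Z X ((a, Y) # \<sigma>) W \<rho>) \<longleftrightarrow>
        (\<exists>W V \<rho>. (W, (a, V) # \<rho>) \<in> LGO q \<and> matches Z X ((a, Y) # \<sigma>) W ((a, V) # \<rho>))"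
    (is "?L \<longleftrightarrow> ?R")
  proof
    assume ?L
    then obtain W \<rho> where *: "(W, \<rho>) \<in> LGO q" "matches Z X ((a, Y) # \<sigma>) W \<rho>" by blast
    then show ?R by (cases \<rho>) fastforce+
  qed blast
  then show ?case using 2 by auto
qed

lemma lin_le_iff_allows:
  "lin_le Z p q \<longleftrightarrow> (\<forall>X \<sigma>. (X, \<sigma>) \<in> LGO p \<longrightarrow> allows Z q X \<sigma>)"
  by (simp add: lin_le_iff_matches allows_iff)

lemma allows_self: "(X, \<sigma>) \<in> LGO p \<Longrightarrow> allows Z p X \<sigma>"
  by (induction Z p X \<sigma> rule: allows.induct) auto

lemma lin_le_refl: "lin_le Z p p"
  by (simp add: lin_le_iff_allows allows_self)

text \<open>A set is needed on the right: after a step, different observations of the same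
  derivative may be matched by different derivatives of the other process.\<close>

definition covers :: "semantics \<Rightarrow> 'a proc \<Rightarrow> 'a proc set \<Rightarrow> bool" where
  "covers Z p Q \<longleftrightarrow> (\<forall>X \<sigma>. (X, \<sigma>) \<in> LGO p \<longrightarrow> (\<exists>q\<in>Q. allows Z q X \<sigma>))"

lemma covers_mono: "covers Z p Q \<Longrightarrow> Q \<subseteq> R \<Longrightarrow> covers Z p R"
  unfolding covers_def by blast

lemma covers_self: "p \<in> Q \<Longrightarrow> covers Z p Q"
  unfolding covers_def using allows_self by blast

lemma covers_singleton: "covers Z p {q} \<longleftrightarrow> lin_le Z p q"
  by (simp add: covers_def lin_le_iff_allows)

text \<open>Observations with no action give the first conjunct; those with a first action give the
  second, where the inner comparison selects the members of \<open>Q\<close> that may make the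
  step.\<close>

lemma covers_iff:
  "covers Z p Q \<longleftrightarrow> (\<exists>q\<in>Q. final_ok Z (initials p) (initials q)) \<and>
    (\<forall>a p'. step p a p' \<longrightarrow>
      covers Z p' {q'. \<exists>q\<in>Q. inner_ok Z (initials p) (initials q) \<and> step q a q'})"
  (is "?L \<longleftrightarrow> ?F \<and> ?S")
proof (intro iffI conjI)
  assume ?L
  then show ?F unfolding covers_def by (metis LGO_Nil allows.simps(1))
  show ?S
    unfolding covers_def
  proof (intro allI impI)
    fix a p' Y \<sigma>
    assume "step p a p'" "(Y, \<sigma>) \<in> LGO p'"
    then have "(initials p, (a, Y) # \<sigma>) \<in> LGO p" by auto
    then obtain q where "q \<in> Q" "allows Z q (initials p) ((a, Y) # \<sigma>)"
      using \<open>?L\<close> unfolding covers_def by blast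
    then show "\<exists>q'\<in>{q'. \<exists>q\<in>Q. inner_ok Z (initials p) (initials q) \<and> step q a q'}. allows Z q' Y \<sigma>"
      by auto
  qed
next
  assume *: "?F \<and> ?S"
  show ?L
    unfolding covers_def
  proof (intro allI impI)
    fix X \<sigma>
    assume obs: "(X, \<sigma>) \<in> LGO p"
    show "\<exists>q\<in>Q. allows Z q X \<sigma>"
    proof (cases \<sigma>)
      case Nil
      then show ?thesis using * obs by auto
    next
      case (Cons aY \<sigma>')
      obtain a Y where aY: "aY = (a, Y)" by (cases aY)
      with Cons obs obtain p' where p': "X = initials p" "step p a p'" "(Y, \<sigma>') \<in> LGO p'"
        by auto
      with * obtain q' where
        "q' \<in> {q'. \<exists>q\<in>Q. inner_ok Z (initials p) (initials q) \<and> step q a q'}" "allows Z q' Y \<sigma>'"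
        unfolding covers_def by blast
      then show ?thesis using p' Cons aY by auto
    qed
  qed
qed

lemma covers_nonempty: "covers Z p Q \<Longrightarrow> Q \<noteq> {}"
  unfolding covers_def by (metis LGO_Nil empty_iff)

lemma lin_le_iff:
  "lin_le Z p q \<longleftrightarrow> initials p = initials q \<and>
    (\<forall>a p'. step p a p' \<longrightarrow> covers Z p' {q'. step q a q'})"
  (is "?L \<longleftrightarrow> ?I \<and> ?S")
proof
  assume ?L
  then have c: "covers Z p {q}" by (simp add: covers_singleton)
  have S: "covers Z p' {q'. step q a q'}" if "step p a p'" for a p'
  proof -
    have "covers Z p' {q'. \<exists>r\<in>{q}. inner_ok Z (initials p) (initials r) \<and> step r a q'}"
      using iffD1 [OF covers_iff c] that by blast
    then show ?thesis by (rule covers_mono) auto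
  qed
  \<comment> \<open>A covering set is nonempty, so each action of \<open>p\<close> has a derivative
    in \<open>q\<close>.\<close>
  have "initials p \<subseteq> initials q"
    using covers_nonempty [OF S] by (auto simp: initials_def)
  moreover have "initials q \<subseteq> initials p"
    using iffD1 [OF covers_iff c] by (auto dest: final_ok_subset)
  ultimately show "?I \<and> ?S" using S by blast
next
  assume "?I \<and> ?S"
  \<comment> \<open>Equal initials turn both comparisons of first sets into instances of
    reflexivity; only the step condition remains.\<close>
  then have "covers Z p {q}"
    by (intro iffD2 [OF covers_iff]) simp
  then show ?L by (simp add: covers_singleton)
qed

section \<open>Soundness\<close>

abbreviation axioms :: "semantics \<Rightarrow> 'a cineq set" where
  "axioms Z \<equiv> B1 \<union> B2 \<union> B3 \<union> B4 \<union> RS \<union> ND Z"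

text \<open>This handles \<open>B1\<close> to \<open>B4\<close>, whose two sides have the same
  transitions.\<close>

lemma lin_le_if_same_steps: "(\<And>a r. step p a r \<longleftrightarrow> step q a r) \<Longrightarrow> lin_le Z p q"
  by (auto simp: lin_le_iff initials_def intro: covers_self)

lemma lin_le_Prefix: "lin_le Z p q \<Longrightarrow> lin_le Z (Prefix a p) (Prefix a q)"
  by (simp add: lin_le_iff [of Z "Prefix a p"] covers_singleton)

lemma lin_le_Plus:
  assumes "lin_le Z p q" "lin_le Z p' q'"
  shows "lin_le Z (p \<oplus> p') (q \<oplus> q')"
proof -
  have "covers Z r {r'. step (q \<oplus> q') a r'}" if "step (p \<oplus> p') a r" for a r
  proof -
    have "covers Z r {r'. step q a r'} \<or> covers Z r {r'. step q' a r'}"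
      using that assms by (auto simp: lin_le_iff)
    then show ?thesis by (auto elim!: covers_mono)
  qed
  then show ?thesis using assms by (simp add: lin_le_iff [of Z])
qed

lemma lin_le_RS: "initials p = initials q \<Longrightarrow> lin_le Z p (p \<oplus> q)"
  by (auto simp: lin_le_iff intro: covers_self)

lemma lin_le_ND:
  assumes "M Z x y w"
  shows "lin_le Z (Prefix a (x \<oplus> y)) (Prefix a x \<oplus> Prefix a (y \<oplus> w))"
proof -
  \<comment> \<open>The final comparison and the steps of \<open>x\<close> are served by
    \<open>x\<close>, the steps of \<open>y\<close> by \<open>y \<oplus> w\<close>. In each case
    \<open>M\<close> supplies the required relations between the initials.\<close>
  have "covers Z (x \<oplus> y) {x, y \<oplus> w}"
    unfolding covers_iff [of Z "x \<oplus> y"] using assms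
    by (cases Z) (auto intro!: covers_self)
  then show ?thesis
    by (auto simp: lin_le_iff elim!: covers_mono)
qed

lemma lin_le_axioms: "Axiom c t u \<in> axioms Z \<Longrightarrow> c s \<Longrightarrow> lin_le Z (subst s t) (subst s u)"
  unfolding B1_def B2_def B3_def B4_def RS_def ND_def equation_def
  by (auto intro: lin_le_ND lin_le_RS) (auto intro!: lin_le_if_same_steps)

lemma soundness: "axioms Z \<turnstile> p \<preceq> q \<Longrightarrow> lin_le Z p q"
proof (induction rule: derivable.induct)
  case (inst c t u s)
  then show ?case by (rule lin_le_axioms)
qed (auto intro: lin_le_refl lin_le_trans lin_le_Prefix lin_le_Plus)

section \<open>Completeness\<close>

lemma derivable_comm: "axioms Z \<turnstile> x \<oplus> y \<preceq> y \<oplus> x"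
  using derivable.inst [of "\<lambda>_. True" "Var VX [+] Var VY" "Var VY [+] Var VX" "axioms Z"
      "\<lambda>v. if v = VX then x else y"]
  by (simp add: B1_def equation_def)

lemma derivable_assoc_right: "axioms Z \<turnstile> (x \<oplus> y) \<oplus> z \<preceq> x \<oplus> (y \<oplus> z)"
  using derivable.inst [of "\<lambda>_. True" "(Var VX [+] Var VY) [+] Var VZ"
      "Var VX [+] (Var VY [+] Var VZ)" "axioms Z"
      "\<lambda>v. if v = VX then x else if v = VY then y else z"]
  by (simp add: B2_def equation_def)

lemma derivable_assoc_left: "axioms Z \<turnstile> x \<oplus> (y \<oplus> z) \<preceq> (x \<oplus> y) \<oplus> z"
  using derivable.inst [of "\<lambda>_. True" "Var VX [+] (Var VY [+] Var VZ)"
      "(Var VX [+] Var VY) [+] Var VZ" "axioms Z"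
      "\<lambda>v. if v = VX then x else if v = VY then y else z"]
  by (simp add: B2_def equation_def)

lemma derivable_idem: "axioms Z \<turnstile> x \<oplus> x \<preceq> x"
  using derivable.inst [of "\<lambda>_. True" "Var VX [+] Var VX" "Var VX" "axioms Z" "\<lambda>_. x"]
  by (simp add: B3_def equation_def)

lemma derivable_Stop_right: "axioms Z \<turnstile> x \<oplus> \<zero> \<preceq> x"
  using derivable.inst [of "\<lambda>_. True" "Var VX [+] TStop" "Var VX" "axioms Z" "\<lambda>_. x"]
  by (simp add: B4_def equation_def)

lemma derivable_RS: "initials x = initials y \<Longrightarrow> axioms Z \<turnstile> x \<preceq> x \<oplus> y"
  using derivable.inst [of "\<lambda>s. initials (s VX) = initials (s VY)" "Var VX" "Var VX [+] Var VY"
      "axioms Z" "\<lambda>v. if v = VX then x else y"]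
  by (simp add: RS_def)

lemma derivable_ND:
  "M Z x y w \<Longrightarrow> axioms Z \<turnstile> Prefix a (x \<oplus> y) \<preceq> Prefix a x \<oplus> Prefix a (y \<oplus> w)"
  using derivable.inst [of "\<lambda>s. M Z (s VX) (s VY) (s VW)" "TPrefix a (Var VX [+] Var VY)"
      "TPrefix a (Var VX) [+] TPrefix a (Var VY [+] Var VW)" "axioms Z"
      "\<lambda>v. if v = VX then x else if v = VY then y else w"]
  by (auto simp: ND_def)

lemma derivable_Stop_left: "axioms Z \<turnstile> \<zero> \<oplus> x \<preceq> x"
  using derivable.trans derivable_comm derivable_Stop_right .

lemma derivable_plus_left: "axioms Z \<turnstile> x \<preceq> y \<Longrightarrow> axioms Z \<turnstile> x \<oplus> z \<preceq> y \<oplus> z"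
  by (rule derivable.plus [OF _ derivable.refl])

lemma derivable_plus_right: "axioms Z \<turnstile> x \<preceq> y \<Longrightarrow> axioms Z \<turnstile> z \<oplus> x \<preceq> z \<oplus> y"
  by (rule derivable.plus [OF derivable.refl])

lemma derivable_left_comm: "axioms Z \<turnstile> x \<oplus> (y \<oplus> z) \<preceq> y \<oplus> (x \<oplus> z)"
  by (rule derivable.trans [OF derivable_assoc_left
        derivable.trans [OF derivable_plus_left [OF derivable_comm] derivable_assoc_right]])

lemma derivable_interchange: "axioms Z \<turnstile> (x \<oplus> y) \<oplus> (z \<oplus> w) \<preceq> (x \<oplus> z) \<oplus> (y \<oplus> w)"
  by (rule derivable.trans [OF derivable_assoc_right
        derivable.trans [OF derivable_plus_right [OF derivable_left_comm] derivable_assoc_left]])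

section \<open>Absorption of summands\<close>

lemma derivable_absorb_derivative: "step q a q' \<Longrightarrow> axioms Z \<turnstile> Prefix a q' \<oplus> q \<preceq> q"
proof (induction rule: step.induct)
  case (prefix a p)
  show ?case by (rule derivable_idem)
next
  case (plus_left p a p' q)
  show ?case
    by (rule derivable.trans [OF derivable_assoc_left derivable_plus_left [OF plus_left.IH]])
next
  case (plus_right p a p' q)
  show ?case
    by (rule derivable.trans [OF derivable_left_comm derivable_plus_right [OF plus_right.IH]])
qed

text \<open>A closed term is a sum of prefixed terms and \<open>\<zero>\<close>, and
  \<open>q\<close> swallows these one after the other.\<close>

lemma derivable_absorb:
  "(\<And>a p'. step p a p' \<Longrightarrow> axioms Z \<turnstile> Prefix a p' \<oplus> q \<preceq> q) \<Longrightarrow> axioms Z \<turnstile> p \<oplus> q \<preceq> q"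
proof (induction p)
  case Stop
  show ?case by (rule derivable_Stop_left)
next
  case (Prefix a p)
  then show ?case by simp
next
  case (Plus p1 p2)
  then have p1: "axioms Z \<turnstile> p1 \<oplus> q \<preceq> q" and p2: "axioms Z \<turnstile> p2 \<oplus> q \<preceq> q" by simp_all
  show ?case
    by (rule derivable.trans [OF derivable_assoc_right
          derivable.trans [OF derivable_plus_right [OF p2] p1]])
qed

text \<open>Each prefixed summand survives in exactly one of the two parts and becomes
  \<open>\<zero>\<close> in the other.\<close>

lemma derivable_restrict_join: "axioms Z \<turnstile> restrict X p \<oplus> restrict (- X) p \<preceq> p"
proof (induction p)
  case Stop
  show ?case by (simp add: derivable_Stop_left)
next
  case (Prefix a p)
  show ?case by (simp add: derivable_Stop_left derivable_Stop_right)
next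
  case (Plus p1 p2)
  show ?case
    unfolding restrict.simps
    by (rule derivable.trans [OF derivable_interchange derivable.plus [OF Plus.IH]])
qed

text \<open>If \<open>q\<close> absorbs both summands on the right of the axiom, it absorbs the
  smaller left side as well.\<close>

lemma derivable_absorb_ND:
  assumes "M Z x y w"
    and "axioms Z \<turnstile> Prefix a x \<oplus> q \<preceq> q"
    and "axioms Z \<turnstile> Prefix a (y \<oplus> w) \<oplus> q \<preceq> q"
  shows "axioms Z \<turnstile> Prefix a (x \<oplus> y) \<oplus> q \<preceq> q"
proof -
  have "axioms Z \<turnstile> (Prefix a x \<oplus> Prefix a (y \<oplus> w)) \<oplus> q \<preceq> Prefix a x \<oplus> q"
    by (rule derivable.trans [OF derivable_assoc_right derivable_plus_right [OF assms(3)]])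
  from derivable.trans [OF this assms(2)] show ?thesis
    by (rule derivable.trans [OF derivable_plus_left [OF derivable_ND [OF assms(1)]]])
qed

text \<open>Start with \<open>k0\<close> and add \<open>restrict X k\<close> for one
  \<open>k\<close> of \<open>K\<close> at a time, by \<open>derivable_absorb_ND\<close>. The result
  is described by its transitions alone, which determine its initials and observations.\<close>

lemma absorbed_sum:
  assumes k0: "step q a k0" "final_ok Z X (initials k0)"
    and "finite K" and K: "\<And>k. k \<in> K \<Longrightarrow> step q a k \<and> inner_ok Z X (initials k)"
  shows "\<exists>r. axioms Z \<turnstile> Prefix a r \<oplus> q \<preceq> q \<and>
    (\<forall>b r'. step r b r' \<longleftrightarrow> step k0 b r' \<or> b \<in> X \<and> (\<exists>k\<in>K. step k b r'))"
  using \<open>finite K\<close> K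
proof (induction K)
  case empty
  show ?case using derivable_absorb_derivative [OF k0(1)] by auto
next
  case (insert k K)
  then obtain r where r: "axioms Z \<turnstile> Prefix a r \<oplus> q \<preceq> q"
    "\<And>b r'. step r b r' \<longleftrightarrow> step k0 b r' \<or> b \<in> X \<and> (\<exists>k\<in>K. step k b r')"
    by auto
  have k: "step q a k" "inner_ok Z X (initials k)" using insert.prems by auto
  have "initials k0 \<subseteq> initials r" "initials r \<subseteq> X"
    using r(2) final_ok_subset [OF k0(2)] by (auto simp: initials_def)
  \<comment> \<open>For \<open>RD\<close> and \<open>RT\<close>, \<open>X = initials k0\<close>
    forces \<open>initials r = X\<close>. For \<open>FT\<close> and \<open>RT\<close>,
    \<open>initials k \<subseteq> X\<close> leaves \<open>restrict (- X) k\<close> without initials;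
    for \<open>RT\<close>, moreover, \<open>initials k = X\<close>.\<close>
  then have "M Z r (restrict X k) (restrict (- X) k)"
    using k(2) k0(2) by (cases Z) auto
  moreover have "axioms Z \<turnstile> Prefix a (restrict X k \<oplus> restrict (- X) k) \<oplus> q \<preceq> q"
    using derivable_plus_left [OF derivable.prefix [OF derivable_restrict_join]]
      derivable_absorb_derivative [OF k(1)]
    by (rule derivable.trans)
  ultimately have "axioms Z \<turnstile> Prefix a (r \<oplus> restrict X k) \<oplus> q \<preceq> q"
    by (rule derivable_absorb_ND [OF _ r(1)])
  moreover have "step (r \<oplus> restrict X k) b r' \<longleftrightarrow>
      step k0 b r' \<or> b \<in> X \<and> (\<exists>k\<in>insert k K. step k b r')" for b r'
    by (auto simp: r(2))
  ultimately show ?case by blast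
qed

text \<open>Replaces a whole set of matching derivatives by a single process above \<open>p\<close>:
  the final comparison provides \<open>k0\<close>, and \<open>K\<close> consists of all derivatives
  passing the inner comparison.\<close>

lemma covers_absorbed_bound:
  assumes cov: "covers Z p {q'. step q a q'}"
  obtains r where "axioms Z \<turnstile> Prefix a r \<oplus> q \<preceq> q" "lin_le Z p r"
proof -
  let ?X = "initials p"
  let ?K = "{k. step q a k \<and> inner_ok Z ?X (initials k)}"
  obtain k0 where k0: "step q a k0" "final_ok Z ?X (initials k0)"
    using conjunct1 [OF iffD1 [OF covers_iff cov]] by blast
  have "finite ?K"
    by (rule finite_subset [OF _ finite_derivatives [of q a]]) auto
  with k0 have "\<exists>r. axioms Z \<turnstile> Prefix a r \<oplus> q \<preceq> q \<and>
    (\<forall>b r'. step r b r' \<longleftrightarrow> step k0 b r' \<or> b \<in> ?X \<and> (\<exists>k\<in>?K. step k b r'))"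
    by (rule absorbed_sum) simp
  then obtain r where r: "axioms Z \<turnstile> Prefix a r \<oplus> q \<preceq> q"
    and step_r: "\<forall>b r'. step r b r' \<longleftrightarrow> step k0 b r' \<or> b \<in> ?X \<and> (\<exists>k\<in>?K. step k b r')"
    by (elim exE conjE)
  have steps: "covers Z p' {r'. step r b r'}" if "step p b p'" for b p'
  proof -
    have "covers Z p' {r'. \<exists>k\<in>{q'. step q a q'}. inner_ok Z ?X (initials k) \<and> step k b r'}"
      using conjunct2 [OF iffD1 [OF covers_iff cov]] that by blast
    \<comment> \<open>Since \<open>b\<close> is an initial action of \<open>p\<close>, restricting
      the members of \<open>?K\<close> to \<open>?X\<close> keeps all their transitions labelled
      \<open>b\<close>.\<close>
    then show ?thesis
      using step_r step_initials [OF that] by (elim covers_mono) blast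
  qed
  have "initials r \<subseteq> ?X"
  proof
    fix b
    assume "b \<in> initials r"
    then obtain r' where "step r b r'" by (auto simp: initials_def)
    then have "step k0 b r' \<or> b \<in> ?X" using step_r by blast
    then show "b \<in> ?X" using final_ok_subset [OF k0(2)] by (auto dest: step_initials)
  qed
  moreover have "?X \<subseteq> initials r"
  proof
    fix b
    assume "b \<in> ?X"
    then obtain p' where "step p b p'" by (auto simp: initials_def)
    from covers_nonempty [OF steps [OF this]] show "b \<in> initials r"
      by (auto simp: initials_def)
  qed
  ultimately have "initials p = initials r" by (rule subset_antisym [rotated])
  then have "lin_le Z p r"
    unfolding lin_le_iff using steps by blast
  with r show ?thesis by (rule that)
qed

text \<open>The induction measures \<open>p\<close> only and keeps \<open>q\<close> arbitrary: it is
  applied to a derivative \<open>p'\<close> and to the constructed bound \<open>r\<close>, whose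
  size is not controlled.\<close>

lemma completeness: "lin_le Z p q \<Longrightarrow> axioms Z \<turnstile> p \<preceq> q"
proof (induction "size p" arbitrary: p q rule: less_induct)
  case less
  have "axioms Z \<turnstile> Prefix a p' \<oplus> q \<preceq> q" if st: "step p a p'" for a p'
  proof -
    have "covers Z p' {q'. step q a q'}"
      using less.prems st by (auto simp: lin_le_iff)
    then obtain r where r: "axioms Z \<turnstile> Prefix a r \<oplus> q \<preceq> q" "lin_le Z p' r"
      by (rule covers_absorbed_bound)
    then have "axioms Z \<turnstile> p' \<preceq> r" using less.hyps step_size [OF st] by blast
    from derivable_plus_left [OF derivable.prefix [OF this]] r(1) show ?thesis
      by (rule derivable.trans)
  qed
  then have "axioms Z \<turnstile> p \<oplus> q \<preceq> q" by (rule derivable_absorb)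
  moreover have "axioms Z \<turnstile> p \<preceq> p \<oplus> q"
    using less.prems by (auto simp: lin_le_iff intro: derivable_RS)
  ultimately show ?case by (rule derivable.trans [rotated])
qed

theorem theorem5p4:
  fixes Z :: semantics and p q :: "'a proc"
  shows "lin_le Z p q \<longleftrightarrow> (B1 \<union> B2 \<union> B3 \<union> B4 \<union> RS \<union> ND Z) \<turnstile> p \<preceq> q"
  using soundness completeness by blast

end
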